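(* Let $n\ge 3$ and $m\ge 1$ be integers, and let $B_1,\dots,B_m$ and $A_1,A_2,A_3$ be real symmetric $n\times n$ matrices. Suppose that $\{B_1,\dots,B_m\}$ can be generated by $\{A_1,A_2,A_3\}$, i.e. there exist real numbers $r_{ij}$ ($i=1,\dots,m$, $j=1,2,3$) such that $B_i=\sum_{j=1}^3 r_{ij}A_j$ for every $i=1,\dots,m$, and suppose that there exists a vector $s\in\mathbb{R}^3$ such that $s_1A_1+s_2A_2+s_3A_3\succ 0$. Then the set $$\{(x^TB_1x,\ x^TB_2x,\ \dots,\ x^TB_mx):\ x\in\mathbb{R}^n\}\subseteq\mathbb{R}^m$$ is a convex cone.
   Context: For a real symmetric matrix $A$, $A\succ 0$ means that $A$ is positive definite. A set $K\subseteq\mathbb{R}^m$ is a cone if for any $x\in K$, $\lambda x\in K$ holds for all $\lambda\ge 0$. *)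

theory Defs
  imports "HOL-Analysis.Analysis"
begin

definition symmetric_matrix :: "real ^ 'n ^ 'n \<Rightarrow> bool"
  where "symmetric_matrix A \<longleftrightarrow> transpose A = A"

definition pos_def_matrix :: "real ^ 'n ^ 'n \<Rightarrow> bool"
  where "pos_def_matrix A \<longleftrightarrow> symmetric_matrix A \<and> (\<forall>x. x \<noteq> 0 \<longrightarrow> 0 < x \<bullet> (A *v x))"

definition joint_range :: "('m \<Rightarrow> real ^ 'n ^ 'n) \<Rightarrow> (real ^ 'm) set"
  where "joint_range B = range (\<lambda>x. \<chi> i. x \<bullet> (B i *v x))"

end

theory Submission
  imports Defs
begin

text \<open>
  Let \<open>Q\<close> be the bilinear map into three-space with components given by the \<open>A j\<close>. Since the set of
  its diagonal values is a cone, it suffices to show that it contains the sum of any two values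
  \<open>y = Q a a\<close> and \<open>z = Q b b\<close>. If \<open>y\<close> and \<open>z\<close> are parallel, this is clear. Otherwise they span a plane;
  composing \<open>Q\<close> with the normal of this plane gives a scalar form \<open>g\<close> that vanishes at \<open>a\<close> and \<open>b\<close>.
  In dimension at least three, the punctured null cone of \<open>g\<close> is connected up to sign, so the
  intermediate value theorem applied along a path in it from \<open>a\<close> to \<open>b\<close> or \<open>-b\<close> finds a nonzero
  point whose value lies on the line spanned by \<open>y + z\<close>; the positive definite combination puts it
  on the correct half of this line. The joint range of \<open>B\<close> is a linear image of this cone.
\<close>

text \<open>Expanding \<open>g\<close> on the segment leaves only terms in \<open>g a a\<close>,
  \<open>g b b\<close> and \<open>g a b\<close>, so the whole segment is null.\<close>

lemma ivt_along_null_segment: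
  fixes g :: "'a::real_normed_vector \<Rightarrow> 'a \<Rightarrow> real" and h :: "'a \<Rightarrow> real"
  assumes g: "bilinear g" and sym: "\<And>x y. g x y = g y x"
    and h: "continuous_on UNIV h"
    and null: "g a a = 0" "g b b = 0" "g a b = 0"
    and nz: "\<And>t. (1 - t) *\<^sub>R a + t *\<^sub>R b \<noteq> 0"
    and "h a \<le> 0" "0 \<le> h b"
  shows "\<exists>x. x \<noteq> 0 \<and> g x x = 0 \<and> h x = 0"
proof -
  let ?p = "\<lambda>t::real. (1 - t) *\<^sub>R a + t *\<^sub>R b"
  have "continuous_on {0..1} (\<lambda>t. h (?p t))"
    by (rule continuous_on_compose2[OF h]) (auto intro!: continuous_intros)
  then obtain t where "h (?p t) = 0"
    using IVT'[of "\<lambda>t. h (?p t)" 0 0 1] assms(8,9) by auto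
  moreover have "g (?p t) (?p t) = 0"
    using null sym[of b a]
    by (simp add: bilinear_ladd[OF g] bilinear_radd[OF g] bilinear_lmul[OF g] bilinear_rmul[OF g])
  ultimately show ?thesis using nz by blast
qed

text \<open>Two linear conditions cannot separate the points of a space of dimension at least
  three.\<close>

lemma exists_nonzero_orthogonal_to_pair:
  fixes g :: "'a::euclidean_space \<Rightarrow> 'a \<Rightarrow> real"
  assumes g: "bilinear g" and "DIM('a) \<ge> 3"
  shows "\<exists>c. c \<noteq> 0 \<and> g a c = 0 \<and> g b c = 0"
proof -
  let ?f = "\<lambda>x. (g a x, g b x)"
  have lin: "linear ?f"
    by (rule linearI) (auto simp: bilinear_radd[OF g] bilinear_rmul[OF g])
  have "\<not> inj ?f"
  proof
    assume "inj ?f"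
    then have "dim (range ?f) = dim (UNIV :: 'a set)"
      using lin by (intro dim_image_eq) auto
    moreover have "dim (range ?f) \<le> DIM(real \<times> real)"
      by (rule dim_subset_UNIV)
    ultimately show False using assms(2) by (simp add: dim_UNIV)
  qed
  then show ?thesis
    using linear_injective_0[OF lin] by (auto simp: zero_prod_def)
qed

text \<open>If \<open>g a b\<close> is nonzero, the null vectors in the plane of \<open>a\<close>
  and \<open>b\<close> form just two lines. A vector \<open>c\<close> orthogonal to both gives room
  to pass between them: through \<open>c\<close> itself if it is null, along a curved arc
  otherwise.\<close>

lemma ivt_on_null_cone:
  fixes g :: "'a::euclidean_space \<Rightarrow> 'a \<Rightarrow> real" and h :: "'a \<Rightarrow> real"
  assumes g: "bilinear g" and sym: "\<And>x y. g x y = g y x" and dim: "DIM('a) \<ge> 3"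
    and h: "continuous_on UNIV h" and even: "\<And>x. h (- x) = h x"
    and null: "g a a = 0" "g b b = 0"
    and indep: "\<And>\<alpha> \<beta>. \<alpha> *\<^sub>R a + \<beta> *\<^sub>R b = 0 \<Longrightarrow> \<alpha> = 0 \<and> \<beta> = 0"
    and ha: "h a \<le> 0" and hb: "0 \<le> h b"
  shows "\<exists>x. x \<noteq> 0 \<and> g x x = 0 \<and> h x = 0"
proof -
  note bil = bilinear_ladd[OF g] bilinear_radd[OF g] bilinear_lmul[OF g] bilinear_rmul[OF g]
    bilinear_lneg[OF g] bilinear_rneg[OF g] bilinear_lzero[OF g] bilinear_rzero[OF g]
  obtain c where c: "c \<noteq> 0" "g a c = 0" "g b c = 0"
    using exists_nonzero_orthogonal_to_pair[OF g dim] by blast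
  have c': "g c a = 0" "g c b = 0" using c sym by metis+
  consider (orth) "g a b = 0" | (cnull) "g a b \<noteq> 0" "g c c = 0" | (hyp) "g a b \<noteq> 0" "g c c \<noteq> 0"
    by blast
  then show ?thesis
  proof cases
    case orth
    have "(1 - t) *\<^sub>R a + t *\<^sub>R b \<noteq> 0" for t
      using indep[of "1 - t" t] by auto
    then show ?thesis
      using ivt_along_null_segment[OF g sym h null orth _ ha hb] by blast
  next
    case cnull
    have ba: "g b a \<noteq> 0" using cnull sym by metis
    show ?thesis
    \<comment> \<open>The sign of \<open>h c\<close> decides which of the segments from
      \<open>a\<close> to \<open>c\<close> and from \<open>c\<close> to \<open>b\<close> has the
      sign change.\<close>
    proof (cases "0 \<le> h c")
      case True
      have "(1 - t) *\<^sub>R a + t *\<^sub>R c \<noteq> 0" for t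
      proof
        assume 0: "(1 - t) *\<^sub>R a + t *\<^sub>R c = 0"
        then have "g b ((1 - t) *\<^sub>R a + t *\<^sub>R c) = 0" by (simp add: bil)
        then have "t = 1" using ba c by (simp add: bil)
        then show False using 0 c by simp
      qed
      then show ?thesis
        using ivt_along_null_segment[OF g sym h null(1) cnull(2) c(2) _ ha True] by blast
    next
      case False
      have "(1 - t) *\<^sub>R c + t *\<^sub>R b \<noteq> 0" for t
      proof
        assume 0: "(1 - t) *\<^sub>R c + t *\<^sub>R b = 0"
        then have "g a ((1 - t) *\<^sub>R c + t *\<^sub>R b) = 0" by (simp add: bil)
        then have "t = 0" using cnull c by (simp add: bil)
        then show False using 0 c by simp
      qed
      then show ?thesis
        using ivt_along_null_segment[OF g sym h cnull(2) null(2) c'(2) _ _ hb] False by auto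
    qed
  next
    case hyp
    \<comment> \<open>Replacing \<open>b\<close> by \<open>- b\<close> flips the sign of
      \<open>g a b\<close> but keeps \<open>h b\<close>; the negative sign makes \<open>k\<close>
      below real.\<close>
    have "\<exists>b'. g b' b' = 0 \<and> g b' c = 0 \<and> g a b' * g c c < 0 \<and> 0 \<le> h b'"
    proof (cases "g a b * g c c < 0")
      case True
      then show ?thesis using null c hb by blast
    next
      case False
      then have "g a b * g c c > 0" using hyp by (simp add: less_le)
      then show ?thesis using null c hb even
        by (intro exI[of _ "- b"]) (simp add: bil)
    qed
    then obtain b' where b': "g b' b' = 0" "g b' c = 0" "g a b' * g c c < 0" "0 \<le> h b'"
      by blast
    have b'2: "g c b' = 0" "g b' a = g a b'" "g a b' \<noteq> 0" using b' sym by auto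
    \<comment> \<open>makes the two products in \<open>g (?p t) (?p t)\<close> below cancel for every \<open>t\<close>\<close>
    define k where "k = sqrt (- 2 * g a b' / g c c)"
    have "- 2 * g a b' / g c c \<ge> 0"
      using b'(3) by (auto simp: mult_less_0_iff divide_nonneg_neg divide_nonpos_pos
          zero_le_divide_iff divide_le_0_iff)
    then have "k\<^sup>2 = - 2 * g a b' / g c c" unfolding k_def by simp
    then have k: "k * k * g c c = - 2 * g a b'"
      using hyp by (simp add: power2_eq_square)
    let ?p = "\<lambda>t::real. (1 - t)\<^sup>2 *\<^sub>R a + t\<^sup>2 *\<^sub>R b' + (t * (1 - t) * k) *\<^sub>R c"
    have "continuous_on {0..1} (\<lambda>t. h (?p t))"
      by (rule continuous_on_compose2[OF h]) (auto intro!: continuous_intros)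
    then obtain t where t: "h (?p t) = 0"
      using IVT'[of "\<lambda>t. h (?p t)" 0 0 1] ha b' by auto
    have "g (?p t) (?p t) = t\<^sup>2 * (1 - t)\<^sup>2 * (2 * g a b' + k * k * g c c)"
      unfolding bil by (simp add: null b' b'2 c c') (simp add: algebra_simps power2_eq_square)
    then have "g (?p t) (?p t) = 0" using k by simp
    moreover have "?p t \<noteq> 0"
    proof
      assume "?p t = 0"
      \<comment> \<open>Pairing with \<open>a\<close> isolates the coefficient of \<open>b'\<close>,
        and pairing with \<open>b'\<close> that of \<open>a\<close>.\<close>
      then have "g a (?p t) = 0" "g b' (?p t) = 0" by (simp_all only: bil)
      then have "t\<^sup>2 = 0 \<and> (1 - t)\<^sup>2 = 0"
        using null b' b'2 c c' by (simp add: bil)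
      then show False by auto
    qed
    ultimately show ?thesis using t by blast
  qed
qed

lemma cone_range_bilinear_diagonal:
  assumes Q: "bilinear Q"
  shows "cone (range (\<lambda>x. Q x x))"
  unfolding cone_def
proof clarify
  fix x and c :: real
  assume "0 \<le> c"
  then have "c *\<^sub>R Q x x = Q (sqrt c *\<^sub>R x) (sqrt c *\<^sub>R x)"
    by (simp add: bilinear_lmul[OF Q] bilinear_rmul[OF Q])
  then show "c *\<^sub>R Q x x \<in> range (\<lambda>x. Q x x)" by blast
qed

text \<open>Three coordinates suit the method: one linear condition describes the plane of two
  values and becomes a null cone; a second one cuts out the line of their sum and is met by the
  intermediate value theorem.\<close>

lemma convex_range_bilinear_diagonal:
  fixes Q :: "'a::euclidean_space \<Rightarrow> 'a \<Rightarrow> real ^ 3"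
  assumes Q: "bilinear Q" and sym: "\<And>x y. Q x y = Q y x" and dim: "DIM('a) \<ge> 3"
    and pos: "\<And>x. x \<noteq> 0 \<Longrightarrow> 0 < s \<bullet> Q x x"
  shows "convex (range (\<lambda>x. Q x x))"
proof -
  note bil = bilinear_ladd[OF Q] bilinear_radd[OF Q] bilinear_lmul[OF Q] bilinear_rmul[OF Q]
    bilinear_lneg[OF Q] bilinear_rneg[OF Q] bilinear_lzero[OF Q] bilinear_rzero[OF Q]
  let ?K = "range (\<lambda>x. Q x x)"
  have cone: "cone ?K" by (rule cone_range_bilinear_diagonal[OF Q])
  have "Q a a + Q b b \<in> ?K" for a b
  proof (cases "cross3 (Q a a) (Q b b) = 0")
    case True
    show ?thesis
    proof (cases "a = 0")
      case True
      then show ?thesis by (simp add: bil)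
    next
      case False
      then have "Q a a \<noteq> 0" using pos[of a] by auto
      then obtain c where c: "Q b b = c *\<^sub>R Q a a"
        using True by (auto simp: cross_eq_0 collinear_lemma)
      \<comment> \<open>Pairing with \<open>s\<close> fixes the sign of the ratio \<open>c\<close>
        of the parallel values.\<close>
      have "0 \<le> s \<bullet> Q b b" using pos[of b] by (cases "b = 0") (auto simp: bil)
      then have "0 \<le> c" using pos[OF False] c by (simp add: zero_le_mult_iff)
      then have "(1 + c) *\<^sub>R Q a a \<in> ?K" using cone by (auto simp: cone_def)
      then show ?thesis by (simp add: c scaleR_add_left)
    qed
  next
    case False
    define y where "y = Q a a"
    define z where "z = Q b b"
    define n where "n = cross3 y z"
    \<comment> \<open>the vectors orthogonal to both \<open>n\<close> and \<open>m\<close> are the multiples of \<open>y + z\<close>\<close>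
    define m where "m = cross3 n (y + z)"
    have n0: "n \<noteq> 0" using False by (simp add: n_def y_def z_def)
    have ny: "n \<bullet> y = 0" and nz: "n \<bullet> z = 0"
      by (simp_all add: n_def dot_cross_self)
    \<comment> \<open>The opposite signs at \<open>y\<close> and \<open>z\<close> supply the sign
      change between \<open>a\<close> and \<open>b\<close>.\<close>
    have my: "m \<bullet> y = - (n \<bullet> n)" and mz: "m \<bullet> z = n \<bullet> n"
      by (simp_all add: m_def n_def cross3_simps)
    have a0: "a \<noteq> 0" and b0: "b \<noteq> 0"
      using False by (auto simp: bil)
    have "\<exists>x. x \<noteq> 0 \<and> n \<bullet> Q x x = 0 \<and> m \<bullet> Q x x = 0"
    proof (rule ivt_on_null_cone[where a = a and b = b and
          g = "\<lambda>x y. n \<bullet> Q x y" and h = "\<lambda>x. m \<bullet> Q x x"])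
      show "bilinear (\<lambda>x y. n \<bullet> Q x y)"
        unfolding bilinear_def by (auto intro!: linearI simp: bil inner_add_right)
      show "n \<bullet> Q x y = n \<bullet> Q y x" for x y by (simp add: sym)
      show "continuous_on UNIV (\<lambda>x. m \<bullet> Q x x)"
        by (intro continuous_intros bilinear_continuous_on_compose[OF _ _ Q])
      show "\<alpha> = 0 \<and> \<beta> = 0" if "\<alpha> *\<^sub>R a + \<beta> *\<^sub>R b = 0" for \<alpha> \<beta>
      proof -
        \<comment> \<open>The diagonal of \<open>Q\<close> ignores signs, so a dependence of
          \<open>a\<close> and \<open>b\<close> makes multiples of \<open>y\<close> and
          \<open>z\<close> with square coefficients equal; cross products with \<open>z\<close> and
          \<open>y\<close> then kill both coefficients.\<close>
        have "\<alpha> *\<^sub>R a = - (\<beta> *\<^sub>R b)" using that by (simp add: eq_neg_iff_add_eq_0)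
        then have "Q (\<alpha> *\<^sub>R a) (\<alpha> *\<^sub>R a) = Q (\<beta> *\<^sub>R b) (\<beta> *\<^sub>R b)" by (simp add: bil)
        then have e: "(\<alpha> * \<alpha>) *\<^sub>R y = (\<beta> * \<beta>) *\<^sub>R z" by (simp add: bil y_def z_def)
        have "(\<alpha> * \<alpha>) *\<^sub>R n = cross3 ((\<alpha> * \<alpha>) *\<^sub>R y) z"
          by (simp add: n_def cross_mult_left)
        then have "\<alpha> = 0" using n0 by (simp add: e cross_mult_left)
        moreover have "(\<beta> * \<beta>) *\<^sub>R n = cross3 y ((\<beta> * \<beta>) *\<^sub>R z)"
          by (simp add: n_def cross_mult_right)
        then have "\<beta> = 0" using n0 by (simp add: e[symmetric] cross_mult_right)
        ultimately show ?thesis by blast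
      qed
    qed (use dim ny nz my mz in \<open>simp_all add: bil flip: y_def z_def\<close>)
    then obtain x where x: "x \<noteq> 0" "n \<bullet> Q x x = 0" "m \<bullet> Q x x = 0" by blast
    \<comment> \<open>By the triple product formula, \<open>cross3 n m\<close> spans the line of
      \<open>y + z\<close>, and \<open>Q x x\<close>, orthogonal to \<open>n\<close> and
      \<open>m\<close>, is parallel to it.\<close>
    have "cross3 n m = - (n \<bullet> n) *\<^sub>R (y + z)"
      by (simp add: m_def Lagrange inner_add_right ny nz)
    moreover have "cross3 (Q x x) (cross3 n m) = 0"
      using x by (simp add: Lagrange inner_commute)
    ultimately have "cross3 (y + z) (Q x x) = 0"
      using n0 cross_skew[of "y + z" "Q x x"] by (simp add: cross_mult_right)
    moreover have spos: "0 < s \<bullet> (y + z)"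
      using pos[OF a0] pos[OF b0] by (simp add: y_def z_def inner_add_right)
    then have "y + z \<noteq> 0" by auto
    ultimately obtain c where c: "Q x x = c *\<^sub>R (y + z)"
      using pos[OF x(1)] by (auto simp: cross_eq_0 collinear_lemma)
    have "0 < c" using pos[OF x(1)] spos by (simp add: c zero_less_mult_iff)
    then have "y + z = (1 / c) *\<^sub>R Q x x" by (simp add: c)
    then show ?thesis
      using cone \<open>0 < c\<close> by (auto simp: cone_def y_def z_def)
  qed
  then show ?thesis using convex_cone[of ?K] cone by (auto simp: cone_def)
qed

theorem theorem2:
  fixes A :: "3 \<Rightarrow> real ^ 'n ^ 'n"
    and B :: "'m::finite \<Rightarrow> real ^ 'n ^ 'n"
  assumes "CARD('n) \<ge> 3"
    and "\<And>j. symmetric_matrix (A j)"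
    and "\<And>i. symmetric_matrix (B i)"
    and "\<exists>r :: real ^ 3 ^ 'm. \<forall>i. B i = (\<Sum>j\<in>UNIV. r $ i $ j *\<^sub>R A j)"
    and "\<exists>s :: real ^ 3. pos_def_matrix (\<Sum>j\<in>UNIV. s $ j *\<^sub>R A j)"
  shows "convex (joint_range B) \<and> cone (joint_range B)"
proof -
  obtain r :: "real ^ 3 ^ 'm" where r: "\<And>i. B i = (\<Sum>j\<in>UNIV. r $ i $ j *\<^sub>R A j)"
    using assms(4) by blast
  obtain s :: "real ^ 3" where s: "pos_def_matrix (\<Sum>j\<in>UNIV. s $ j *\<^sub>R A j)"
    using assms(5) by blast
  define Q :: "real ^ 'n \<Rightarrow> real ^ 'n \<Rightarrow> real ^ 3" where "Q = (\<lambda>x y. \<chi> j. x \<bullet> (A j *v y))"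
  \<comment> \<open>Serves twice: with \<open>c\<close> equal to \<open>s\<close> for positivity,
    and with \<open>c\<close> a row of \<open>r\<close> for \<open>B i\<close>.\<close>
  have combine: "x \<bullet> ((\<Sum>j\<in>UNIV. c $ j *\<^sub>R A j) *v x) = c \<bullet> Q x x" for c :: "real ^ 3" and x
  proof -
    have "(\<Sum>j\<in>UNIV. c $ j *\<^sub>R A j) *v x = (\<Sum>j\<in>UNIV. c $ j *\<^sub>R (A j *v x))"
      by (simp add: sum_3 matrix_vector_mult_add_rdistrib scaleR_matrix_vector_assoc)
    then show ?thesis by (simp add: Q_def inner_vec_def[of c] inner_sum_right)
  qed
  have Q: "bilinear Q"
    unfolding bilinear_def
    by (auto intro!: linearI simp: Q_def vec_eq_iff inner_add_left inner_add_right
        matrix_vector_right_distrib matrix_vector_mult_scaleR)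
  have "x \<bullet> (A j *v y) = y \<bullet> (A j *v x)" for x y j
  proof -
    have "x v* A j = A j *v x"
      using assms(2)[of j] by (simp add: symmetric_matrix_def flip: transpose_matrix_vector)
    then show ?thesis
      using dot_lmul_matrix[of x "A j" y] by (simp add: inner_commute)
  qed
  then have sym: "Q x y = Q y x" for x y
    by (simp add: Q_def)
  have pos: "0 < s \<bullet> Q x x" if "x \<noteq> 0" for x
    using s that by (simp add: pos_def_matrix_def flip: combine)
  have "(\<chi> i. x \<bullet> (B i *v x)) = r *v Q x x" for x
    by (simp only: r combine matrix_mult_dot[of r])
  then have range: "joint_range B = (*v) r ` range (\<lambda>x. Q x x)"
    by (simp add: joint_range_def image_image)
  have "convex (range (\<lambda>x. Q x x))"
    using convex_range_bilinear_diagonal[OF Q sym _ pos] assms(1) by simp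
  then have "convex (joint_range B)"
    unfolding range by (rule convex_linear_image[OF matrix_vector_mul_linear])
  moreover have "cone (joint_range B)"
    unfolding range cone_def
  proof clarify
    fix x and c :: real
    assume "0 \<le> c"
    then have "c *\<^sub>R Q x x \<in> range (\<lambda>x. Q x x)"
      using cone_range_bilinear_diagonal[OF Q] by (simp add: cone_def)
    then show "c *\<^sub>R (r *v Q x x) \<in> (*v) r ` range (\<lambda>x. Q x x)"
      unfolding matrix_vector_mult_scaleR[symmetric] by (rule imageI)
  qed
  ultimately show ?thesis by blast
qed

end
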